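(* Let $(K,v)$ be a valued field and let $w$ be an extension of $v$ to $K(X)$. If $w$ has an optimal Maclane chain of the form $$w_{-\infty}\xrightarrow{\phi_0,\gamma_0}w_0\xrightarrow{\phi_1,\gamma_1}w_1\xrightarrow{\phi_2,\gamma_2}\cdots\longrightarrow w_{r-1}\xrightarrow{\phi_r,\gamma_r}w_r=w,$$ then $\{\phi_0\}\cup\{\phi_1\}\cup\cdots\cup\{\phi_r\}$ is a complete set of abstract key polynomials (ABKPs) for $w$.
   Context: Valuations have arbitrary rank. $\overline K$ is a fixed algebraic closure of $K$, $\bar v$ is an extension of $v$ to $\overline K$, and $\overline w$ is a fixed common extension of $w$ and $\bar v$ to $\overline K(X)$. $\Gamma_u$ denotes the value group of $u$. ABKPs: for $f\in K[X]$, $\delta(f):=\max\{\overline w(X-\alpha)\mid \alpha\in\overline K,\ f(\alpha)=0\}$. A monic $Q\in K[X]$ is an ABKP for $w$ if $\delta(f)<\delta(Q)$ for every $f\in K[X]$ with $\deg f<\deg Q$ (constants impose no condition). The $Q$-truncation of $w$ is $w_Q(f):=\min_i w(f_iQ^i)$, where $f=\sum_i f_iQ^i$, $\deg f_i<\deg Q$. Complete set: a family $\Lambda=\{Q_i\}_{i\in\Delta}$ of ABKPs for $w$ is a complete set of ABKPs for $w$ if (i) $\delta(Q_i)\ne\delta(Q_j)$ for every $i\neq j\in\Delta$; (ii) $\Lambda$ is well-ordered with respect to the ordering given by $Q_i<Q_j$ if and only if $\delta(Q_i)<\delta(Q_j)$ for every $i<j\in\Delta$; (iii) for any $f\in K[X]$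 there is some $Q_i\in\Lambda$ with $w_{Q_i}(f)=w(f)$. Standing assumption: all complete sets of ABKPs $\{Q_i\}_{i\in\Delta}$ are assumed to satisfy the following properties. (a) $\Delta=\bigcup_{j\in I}\Delta_j$ with $I=\{0,\ldots,N\}$ or $I=\mathbb N\cup\{0\}$, and for each $j\in I$, $\Delta_j=\{j\}\cup\vartheta_j$, where $\vartheta_j$ is an ordered set without a maximal element or is empty. (b) $Q_0=X$. (c) For all $j\in I\setminus\{0\}$, $j-1<i<j$ for all $i\in\vartheta_{j-1}$. (d) All $Q_i$ with $i\in\Delta_j$ have the same degree, strictly less than the degree of $Q_{i'}$ for every $i'\in\Delta_{j+1}$. (e) For each $i<i'\in\Delta$, $w(Q_i)<w(Q_{i'})$ and $\delta(Q_i)<\delta(Q_{i'})$. (f) Even though the set $\{Q_i\}_{i\in\Delta}$ is not unique, the cardinality of $I$ and the degree of $Q_i$ for each $i\in I$ are uniquely determined by $w$. (g) $\Delta$ has a maximal element if and only if $I=\{0,\ldots,N\}$ is finite and $\Delta_N=\{N\}$, i.e. $\vartheta_N=\emptyset$. Key polynomials: for a valuation $u$ and $f,g\in K[X]$ write $f\sim_u g$ if $u(f-g)>u(f)=u(g)$; $f\mid_u g$ if $g\sim_u fh$ for some $h\in K[X]$. $f$ is $u$-irreducible if $f\mid_u hq$ implies $f\mid_u h$ or $f\mid_u q$; $f$ is $u$-minimal if $f\mid_u h$ (with $h\ne0$) implies $\deg h\ge\deg f$. A key polynomial for $u$ is a monic polynomial that is $u$-irreducible and $u$-minimal. Ordinary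 augmentation: if $\phi$ is a key polynomial for $u$ and $\gamma>u(\phi)$ lies in a totally ordered abelian group containing $\Gamma_u$ as an ordered subgroup, then $[u;\phi,\gamma]$ is the valuation $\sum_i f_i\phi^i\mapsto\min_i\{u(f_i)+i\gamma\}$ ($\deg f_i<\deg\phi$). Minimal extension: $w_{-\infty}(f)=(-\deg f,v(a_n))\in\mathbb Z\times\Gamma_v$ (lexicographic order), where $a_n$ is the leading coefficient of $f\neq0$. Its key polynomials are the $X+a$, $a\in K$. With the embedding $\Gamma_v\otimes\mathbb Q\hookrightarrow\mathbb Z\times(\Gamma_v\otimes\mathbb Q)$, $\gamma\mapsto(0,\gamma)$, the augmentation $w_0=[w_{-\infty};\phi_0,\gamma_0]$ with $\phi_0=X+a$, $\gamma_0\in\Gamma_v\otimes\mathbb Q$ is the valuation $\sum_i a_i\phi_0^i\mapsto\min_i\{v(a_i)+i\gamma_0\}$ ($a_i\in K$). Optimal Maclane chain of $w$: a finite chain $w_{-\infty}\xrightarrow{\phi_0,\gamma_0}w_0\xrightarrow{\phi_1,\gamma_1}\cdots\xrightarrow{\phi_r,\gamma_r}w_r=w$ with $\gamma_0,\ldots,\gamma_r\in\Gamma_v\otimes\mathbb Q$, $w_0=[w_{-\infty};\phi_0,\gamma_0]$, each $w_i=[w_{i-1};\phi_i,\gamma_i]$ an ordinary augmentation ($1\le i\le r$), and, with $m_i=\deg\phi_i$, $1=m_0\mid m_1\mid\cdots\mid m_r$ and $m_0<m_1<\cdots<m_r$. *)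

theory Defs
  imports
    "HOL-Library.Extended"
    "HOL-Library.Product_Lexorder"
    "HOL-Library.Product_Plus"
    "HOL-Algebra.Algebraic_Closure_Type"
    "HOL-Computational_Algebra.Polynomial_Factorial"
begin

section \<open>Valuations\<close>

text \<open>
  Valuations are written additively. All valuations extending one another take values in one
  ordered abelian group, with \<^term>\<open>\<infinity>\<close> adjoined as the value of \<^term>\<open>0\<close>; the element
  \<^term>\<open>-\<infinity>\<close> of the type \<^typ>\<open>'g extended\<close> is never attained.
\<close>

definition valuation :: "('f::field \<Rightarrow> 'g::linordered_ab_group_add extended) \<Rightarrow> bool" where
  "valuation u \<longleftrightarrow>
     (\<forall>x. u x \<noteq> -\<infinity>) \<and> (\<forall>x. u x = \<infinity> \<longleftrightarrow> x = 0) \<and>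
     (\<forall>x y. u (x * y) = u x + u y) \<and>
     (\<forall>x y. min (u x) (u y) \<le> u (x + y))"

definition value_group :: "('f::field \<Rightarrow> 'g::linordered_ab_group_add extended) \<Rightarrow> 'g set" where
  "value_group u = {\<gamma>. \<exists>x. x \<noteq> 0 \<and> u x = Fin \<gamma>}"

definition nat_mult :: "nat \<Rightarrow> 'g::comm_monoid_add \<Rightarrow> 'g" where
  "nat_mult n \<gamma> = (\<Sum>_<n. \<gamma>)"

text \<open>
  Elements of the ambient ordered group having a positive multiple in \<open>G\<close>. If \<open>v\<close> has an extension
  to the algebraic closure with values in the ambient group, then the value group of that extension
  is divisible, so that \<open>rational_hull (value_group v)\<close> is a copy of \<open>\<Gamma>\<^sub>v \<otimes> \<rat>\<close> and not merely a
  part of it.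
\<close>

definition rational_hull :: "'g::linordered_ab_group_add set \<Rightarrow> 'g set" where
  "rational_hull G = {\<gamma>. \<exists>n>0. nat_mult n \<gamma> \<in> G}"

text \<open>With \<open>L\<close> the algebraic closure of \<open>K\<close>, the fields \<open>K(X)\<close> and \<open>L(X)\<close> are fields of fractions of polynomial rings; the extension
  relations are stated along the canonical embeddings \<open>K \<rightarrow> K(X)\<close>, \<open>K \<rightarrow> L\<close> and
  \<open>K(X) \<rightarrow> L(X)\<close>.\<close>

definition extends_to_rat ::
  "('f::field \<Rightarrow> 'g extended) \<Rightarrow> ('f poly fract \<Rightarrow> 'g extended) \<Rightarrow> bool" where
  "extends_to_rat v w \<longleftrightarrow> (\<forall>a. w (to_fract [:a:]) = v a)"

definition extends_to_ac ::
  "('k::field \<Rightarrow> 'g extended) \<Rightarrow> ('k alg_closure \<Rightarrow> 'g extended) \<Rightarrow> bool" where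
  "extends_to_ac v vbar \<longleftrightarrow> (\<forall>a. vbar (to_ac a) = v a)"

definition extends_rat_to_ac ::
  "('k::field poly fract \<Rightarrow> 'g extended) \<Rightarrow> ('k alg_closure poly fract \<Rightarrow> 'g extended) \<Rightarrow> bool" where
  "extends_rat_to_ac w wbar \<longleftrightarrow>
     (\<forall>f g. g \<noteq> 0 \<longrightarrow>
        wbar (to_fract (map_poly to_ac f) / to_fract (map_poly to_ac g)) =
        w (to_fract f / to_fract g))"


section \<open>Expansions, truncations and augmentations\<close>

definition adic_coeff :: "'k::field poly \<Rightarrow> 'k poly \<Rightarrow> nat \<Rightarrow> 'k poly" where
  "adic_coeff Q f i = (f div Q ^ i) mod Q"

text \<open>The \<open>Q\<close>-adic coefficients give the \<open>Q\<close>-expansion of \<open>f\<close>, which has no terms beyond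
  \<open>Q ^ degree f\<close>.\<close>

lemma degree_adic_coeff:
  assumes "degree Q > 0"
  shows "degree (adic_coeff Q f i) < degree Q"
  using assms degree_mod_less[of Q "f div Q ^ i"]
  by (cases "Q = 0") (auto simp: adic_coeff_def)

lemma adic_expansion_upto:
  "f = (\<Sum>i<n. adic_coeff Q f i * Q ^ i) + (f div Q ^ n) * Q ^ n"
proof (induction n)
  case (Suc n)
  have "f div Q ^ n = (f div Q ^ n) div Q * Q + adic_coeff Q f n"
    by (simp add: adic_coeff_def)
  moreover have "(f div Q ^ n) div Q = f div Q ^ Suc n"
    by (metis poly_div_mult_right power_Suc2)
  ultimately have "(f div Q ^ n) * Q ^ n =
      adic_coeff Q f n * Q ^ n + (f div Q ^ Suc n) * Q ^ Suc n"
    by (metis (no_types, lifting) add.commute distrib_right mult.assoc power_Suc)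
  with Suc show ?case by (simp add: add.assoc)
qed simp

lemma adic_expansion:
  assumes "degree Q > 0"
  shows "f = (\<Sum>i\<le>degree f. adic_coeff Q f i * Q ^ i)"
proof -
  have "degree f < Suc (degree f) * degree Q"
    using assms by (metis One_nat_def Suc_leI lessI less_le_trans mult.right_neutral mult_le_mono2)
  moreover have "degree (Q ^ Suc (degree f)) = Suc (degree f) * degree Q"
    using assms by (subst degree_power_eq) auto
  ultimately have "f div Q ^ Suc (degree f) = 0"
    by (intro div_poly_less) simp
  with adic_expansion_upto[of f Q "Suc (degree f)"] show ?thesis
    by (simp add: lessThan_Suc_atMost)
qed

definition truncation ::
  "('k::field poly fract \<Rightarrow> 'g::linordered_ab_group_add extended) \<Rightarrow> 'k poly \<Rightarrow> 'k poly \<Rightarrow> 'g extended" where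
  "truncation w Q f = Min ((\<lambda>i. w (to_fract (adic_coeff Q f i * Q ^ i))) ` {..degree f})"

definition augmentation ::
  "('k::field poly \<Rightarrow> 'g::linordered_ab_group_add extended) \<Rightarrow> 'k poly \<Rightarrow> 'g \<Rightarrow> 'k poly \<Rightarrow> 'g extended" where
  "augmentation u \<phi> \<gamma> f = Min ((\<lambda>i. u (adic_coeff \<phi> f i) + Fin (nat_mult i \<gamma>)) ` {..degree f})"


section \<open>Key polynomials\<close>

definition val_equiv :: "('k::field poly \<Rightarrow> 'g::linorder extended) \<Rightarrow> 'k poly \<Rightarrow> 'k poly \<Rightarrow> bool" where
  "val_equiv u f g \<longleftrightarrow> u (f - g) > u f \<and> u f = u g"

definition val_dvd :: "('k::field poly \<Rightarrow> 'g::linorder extended) \<Rightarrow> 'k poly \<Rightarrow> 'k poly \<Rightarrow> bool" where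
  "val_dvd u f g \<longleftrightarrow> (\<exists>h. val_equiv u g (f * h))"

definition val_irreducible :: "('k::field poly \<Rightarrow> 'g::linorder extended) \<Rightarrow> 'k poly \<Rightarrow> bool" where
  "val_irreducible u f \<longleftrightarrow> (\<forall>h q. val_dvd u f (h * q) \<longrightarrow> val_dvd u f h \<or> val_dvd u f q)"

definition val_minimal :: "('k::field poly \<Rightarrow> 'g::linorder extended) \<Rightarrow> 'k poly \<Rightarrow> bool" where
  "val_minimal u f \<longleftrightarrow> (\<forall>h. h \<noteq> 0 \<and> val_dvd u f h \<longrightarrow> degree h \<ge> degree f)"

definition key_poly :: "('k::field poly \<Rightarrow> 'g::linorder extended) \<Rightarrow> 'k poly \<Rightarrow> bool" where
  "key_poly u \<phi> \<longleftrightarrow> lead_coeff \<phi> = 1 \<and> val_irreducible u \<phi> \<and> val_minimal u \<phi>"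

definition ordinary_augmentation ::
  "('k::field poly \<Rightarrow> 'g::linordered_ab_group_add extended) \<Rightarrow> 'k poly \<Rightarrow> 'g \<Rightarrow>
   ('k poly \<Rightarrow> 'g extended) \<Rightarrow> bool" where
  "ordinary_augmentation u \<phi> \<gamma> u' \<longleftrightarrow>
     key_poly u \<phi> \<and> u \<phi> < Fin \<gamma> \<and> u' = augmentation u \<phi> \<gamma>"


section \<open>Optimal Maclane chains\<close>

text \<open>Products of ordered groups are ordered lexicographically.\<close>

instance prod :: (linordered_ab_group_add, linordered_ab_group_add) linordered_ab_group_add
  by standard (auto simp: less_eq_prod_def plus_prod_def)

text \<open>\<open>f \<mapsto> (- deg f, v (lead_coeff f))\<close>, and \<open>0 \<mapsto> \<infinity>\<close> because \<open>v 0 = \<infinity>\<close>.\<close>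

definition minimal_extension ::
  "('k::field \<Rightarrow> 'g extended) \<Rightarrow> 'k poly \<Rightarrow> (int \<times> 'g) extended" where
  "minimal_extension v f = map_extended (\<lambda>\<gamma>. (- int (degree f), \<gamma>)) (v (lead_coeff f))"

text \<open>The first step of a chain takes place in the value group \<open>\<int> \<times> \<Gamma>\<close> of the minimal extension,
  into which \<open>\<Gamma>\<close> is embedded by \<open>\<gamma> \<mapsto> (0, \<gamma>)\<close>; the function \<open>W i\<close> is the valuation \<open>w\<^sub>i\<close>,
  restricted to \<open>K[X]\<close>.\<close>

definition optimal_Maclane_chain ::
  "('k::field \<Rightarrow> 'g::linordered_ab_group_add extended) \<Rightarrow> ('k poly fract \<Rightarrow> 'g extended) \<Rightarrow>
   nat \<Rightarrow> (nat \<Rightarrow> 'k poly) \<Rightarrow> (nat \<Rightarrow> 'g) \<Rightarrow> (nat \<Rightarrow> 'k poly \<Rightarrow> 'g extended) \<Rightarrow> bool" where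
  "optimal_Maclane_chain v w r \<phi> \<gamma> W \<longleftrightarrow>
     (\<forall>i\<le>r. \<gamma> i \<in> rational_hull (value_group v)) \<and>
     ordinary_augmentation (minimal_extension v) (\<phi> 0) (0, \<gamma> 0) (map_extended (Pair 0) \<circ> W 0) \<and>
     (\<forall>i<r. ordinary_augmentation (W i) (\<phi> (Suc i)) (\<gamma> (Suc i)) (W (Suc i))) \<and>
     (\<forall>f. W r f = w (to_fract f)) \<and>
     degree (\<phi> 0) = 1 \<and>
     (\<forall>i<r. degree (\<phi> i) dvd degree (\<phi> (Suc i)) \<and> degree (\<phi> i) < degree (\<phi> (Suc i)))"


section \<open>Complete sets of abstract key polynomials\<close>

text \<open>The maximum is meaningful only for nonconstant polynomials, which have a nonempty finite
  set of roots; it is used for no others.\<close>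

definition delta ::
  "('k::field alg_closure poly fract \<Rightarrow> 'g::linordered_ab_group_add extended) \<Rightarrow> 'k poly \<Rightarrow> 'g extended" where
  "delta wbar f = Max {wbar (to_fract [:- \<alpha>, 1:]) |\<alpha>. poly (map_poly to_ac f) \<alpha> = 0}"

definition ABKP ::
  "('k::field alg_closure poly fract \<Rightarrow> 'g::linordered_ab_group_add extended) \<Rightarrow> 'k poly \<Rightarrow> bool" where
  "ABKP wbar Q \<longleftrightarrow>
     lead_coeff Q = 1 \<and> degree Q > 0 \<and>
     (\<forall>f. 0 < degree f \<and> degree f < degree Q \<longrightarrow> delta wbar f < delta wbar Q)"

definition complete_ABKPs ::
  "('k::field poly fract \<Rightarrow> 'g::linordered_ab_group_add extended) \<Rightarrow>
   ('k alg_closure poly fract \<Rightarrow> 'g extended) \<Rightarrow> 'i set \<Rightarrow> ('i \<Rightarrow> 'k poly) \<Rightarrow> bool" where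
  "complete_ABKPs w wbar \<Delta> Q \<longleftrightarrow>
     (\<forall>i\<in>\<Delta>. ABKP wbar (Q i)) \<and>
     (\<forall>i\<in>\<Delta>. \<forall>j\<in>\<Delta>. i \<noteq> j \<longrightarrow> delta wbar (Q i) \<noteq> delta wbar (Q j)) \<and>
     well_order_on (Q ` \<Delta>)
       {(P, P'). P \<in> Q ` \<Delta> \<and> P' \<in> Q ` \<Delta> \<and> (P = P' \<or> delta wbar P < delta wbar P')} \<and>
     (\<forall>f. \<exists>i\<in>\<Delta>. truncation w (Q i) f = w (to_fract f))"

text \<open>
  The customary indexing of a complete set: \<open>\<Delta>\<close> is the union of the blocks \<open>{j} \<union> \<theta> j\<close> for \<open>j\<close> in
  an initial segment \<open>I\<close> of the natural numbers, where \<open>\<iota>\<close> embeds \<open>I\<close> into the ordered index type.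
  The normalisations \<open>Q\<^sub>0 = X\<close> and \<open>w(Q\<^sub>i) < w(Q\<^sub>j)\<close> for \<open>i < j\<close> sometimes also made are not part
  of it: they fail for \<open>Q\<^sub>0 = X + 1\<close>, and for the Maclane chain over \<open>\<rat>\<close> with the \<open>2\<close>-adic valuation given by
  \<open>\<phi>\<^sub>0 = X\<close>, \<open>\<gamma>\<^sub>0 = -1\<close>, \<open>\<phi>\<^sub>1 = X\<^sup>2 + X/2 + 1/4\<close>, \<open>\<gamma>\<^sub>1 = -3/2\<close>.
\<close>

definition standard_indexing ::
  "('k::field alg_closure poly fract \<Rightarrow> 'g::linordered_ab_group_add extended) \<Rightarrow>
   'i::linorder set \<Rightarrow> ('i \<Rightarrow> 'k poly) \<Rightarrow> bool" where
  "standard_indexing wbar \<Delta> Q \<longleftrightarrow>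
     (\<exists>(I :: nat set) (\<iota> :: nat \<Rightarrow> 'i) (\<theta> :: nat \<Rightarrow> 'i set).
        (I = UNIV \<or> (\<exists>N. I = {..N})) \<and>
        (\<forall>j\<in>I. \<forall>k\<in>I. j < k \<longrightarrow> \<iota> j < \<iota> k) \<and>
        \<Delta> = (\<Union>j\<in>I. insert (\<iota> j) (\<theta> j)) \<and>
        (\<forall>j\<in>I. \<forall>i\<in>\<theta> j. \<exists>i'\<in>\<theta> j. i < i') \<and>
        (\<forall>j\<in>I. \<forall>i\<in>\<theta> j. \<iota> j < i \<and> (Suc j \<in> I \<longrightarrow> i < \<iota> (Suc j))) \<and>
        (\<forall>j\<in>I. \<forall>i\<in>insert (\<iota> j) (\<theta> j). degree (Q i) = degree (Q (\<iota> j))) \<and>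
        (\<forall>j\<in>I. Suc j \<in> I \<longrightarrow> degree (Q (\<iota> j)) < degree (Q (\<iota> (Suc j)))) \<and>
        (\<forall>i\<in>\<Delta>. \<forall>i'\<in>\<Delta>. i < i' \<longrightarrow> delta wbar (Q i) < delta wbar (Q i')) \<and>
        ((\<exists>m\<in>\<Delta>. \<forall>i\<in>\<Delta>. i \<le> m) \<longleftrightarrow> (\<exists>N. I = {..N} \<and> \<theta> N = {})))"

end

theory Submission
  imports Defs
begin

text \<open>
  Let \<open>L\<close> be the algebraic closure of \<open>K\<close>, let \<open>Q\<close> be an abstract key polynomial and \<open>\<alpha>\<close> a root of \<open>Q\<close>
  for which \<open>wbar (X - \<alpha>)\<close> takes the maximal value \<open>d = delta Q\<close>. The proof compares the truncation of
  \<open>w\<close> at \<open>Q\<close> with the Gauss valuation \<open>\<Sum> c\<^sub>i (X - \<alpha>)\<^sup>i \<mapsto> min (vbar c\<^sub>i + i d)\<close> on \<open>L[X]\<close>. In terms of the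
  last index \<open>k\<close> at which this minimum is attained:

  \<^item> The Gauss value of \<open>X - \<beta>\<close> is \<open>min d (wbar (X - \<beta>))\<close>, and its last minimal index is \<open>0\<close> or \<open>1\<close>
    according to whether \<open>wbar (X - \<beta>) < d\<close> or not. Minimal values and last minimal indices add up
    over products. Factoring over \<open>L\<close>, one finds that the Gauss value of \<open>f\<close> is at most \<open>wbar f\<close>, that
    the two agree precisely when \<open>delta f \<le> d\<close>, and that \<open>k\<close> counts the roots \<open>\<beta>\<close> of \<open>f\<close> with
    \<open>wbar (X - \<beta>) \<ge> d\<close> (\<open>dominant_centred\<close>).
  \<^item> Hence \<open>k = 0\<close> for all nonzero polynomials of degree less than \<open>degree Q\<close>, because \<open>Q\<close> is an abstract
    key polynomial, whereas \<open>k > 0\<close> for \<open>Q\<close>, because of the root \<open>\<alpha>\<close>. So the terms of a \<open>Q\<close>-expansion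
    have pairwise different last minimal indices, which excludes cancellation in their sum
    (\<open>dominant_sum\<close>). Therefore the truncation of \<open>w\<close> at \<open>Q\<close> is the restriction of the Gauss valuation
    (\<open>truncation_eq_dominant_value\<close>).

  Together these say that truncating at \<open>Q\<close> preserves the value of \<open>f\<close> if and only if
  \<open>delta f \<le> delta Q\<close> (\<open>truncation_eq_iff_delta_le\<close>). Now let \<open>\<phi>\<^sub>i\<close> and \<open>\<phi>\<^sub>i\<^sub>+\<^sub>1\<close> be consecutive polynomials of the
  chain, and suppose that \<open>\<phi>\<^sub>i\<close> is an abstract key polynomial. The degrees in the chain increase, so
  later augmentations do not change values in degrees below \<open>degree \<phi>\<^sub>i\<^sub>+\<^sub>1\<close>. It follows that \<open>W\<^sub>i\<close> is the
  truncation of \<open>w\<close> at \<open>\<phi>\<^sub>i\<close>, and that it has the value of \<open>w\<close> on all \<open>f\<close> of degree less than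
  \<open>degree \<phi>\<^sub>i\<^sub>+\<^sub>1\<close> but a smaller one on \<open>\<phi>\<^sub>i\<^sub>+\<^sub>1\<close>. By the criterion,
  \<open>delta f \<le> delta \<phi>\<^sub>i < delta \<phi>\<^sub>i\<^sub>+\<^sub>1\<close> for all these nonconstant \<open>f\<close>, so \<open>\<phi>\<^sub>i\<^sub>+\<^sub>1\<close> is an abstract key polynomial
  as well. Completeness is clear, since the truncation at the last polynomial is \<open>w\<close> itself.
\<close>

section \<open>Arithmetic of valuations\<close>

lemma valuationD:
  assumes "valuation u"
  shows "u x \<noteq> -\<infinity>" "u x = \<infinity> \<longleftrightarrow> x = 0" "u (x * y) = u x + u y" "min (u x) (u y) \<le> u (x + y)"
  using assms unfolding valuation_def by auto

lemma valuation_0: "valuation u \<Longrightarrow> u 0 = \<infinity>"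
  by (simp add: valuationD(2))

lemma valuation_Fin:
  assumes "valuation u" "x \<noteq> 0"
  obtains c where "u x = Fin c"
  using valuationD(1,2)[OF assms(1)] assms(2) by (cases "u x") auto

lemma valuation_1:
  fixes u :: "'f::field \<Rightarrow> 'g::linordered_ab_group_add extended"
  assumes "valuation u" shows "u 1 = 0"
proof -
  obtain c where c: "u 1 = Fin c" using valuation_Fin[OF assms one_neq_zero] .
  have "u 1 = u 1 + u 1" using valuationD(3)[OF assms, of 1 1] by simp
  with c show ?thesis by (simp add: zero_extended_def)
qed

lemma valuation_uminus:
  fixes u :: "'f::field \<Rightarrow> 'g::linordered_ab_group_add extended"
  assumes "valuation u" shows "u (- x) = u x"
proof -
  obtain c where c: "u (-1) = Fin c" using valuation_Fin[OF assms, of "-1"] by auto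
  have "u (-1) + u (-1) = 0"
    using valuationD(3)[OF assms, of "-1" "-1"] valuation_1[OF assms] by simp
  then have "c + c = 0" using c by (simp add: zero_extended_def)
  then have "c = 0" by (simp add: double_zero)
  then show ?thesis using valuationD(3)[OF assms, of "-1" x] c
    by (simp add: zero_extended_def[symmetric])
qed

lemma valuation_add_eq:
  fixes u :: "'f::field \<Rightarrow> 'g::linordered_ab_group_add extended"
  assumes "valuation u" "u x < u y" shows "u (x + y) = u x"
proof -
  have "min (u (x + y)) (u (- y)) \<le> u x" using valuationD(4)[OF assms(1), of "x + y" "- y"] by simp
  moreover have "min (u x) (u y) \<le> u (x + y)" by (rule valuationD(4)[OF assms(1)])
  ultimately show ?thesis using assms by (simp add: valuation_uminus min_def split: if_splits)
qed

lemma valuation_sum_ge: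
  assumes "valuation u" "\<And>i. i \<in> A \<Longrightarrow> M \<le> u (t i)"
  shows "M \<le> u (\<Sum>i\<in>A. t i)"
  using assms(2)
proof (induction A rule: infinite_finite_induct)
  case (insert a A)
  then have "M \<le> min (u (t a)) (u (\<Sum>i\<in>A. t i))" by simp
  also have "\<dots> \<le> u (t a + (\<Sum>i\<in>A. t i))" by (rule valuationD(4)[OF assms(1)])
  finally show ?case using insert by simp
qed (simp_all add: valuation_0[OF assms(1)])

lemma valuation_sum_gt:
  assumes "valuation u" "\<And>i. i \<in> A \<Longrightarrow> Fin M < u (t i)"
  shows "Fin M < u (\<Sum>i\<in>A. t i)"
  using assms(2)
proof (induction A rule: infinite_finite_induct)
  case (insert a A)
  then have "Fin M < min (u (t a)) (u (\<Sum>i\<in>A. t i))" by simp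
  also have "\<dots> \<le> u (t a + (\<Sum>i\<in>A. t i))" by (rule valuationD(4)[OF assms(1)])
  finally show ?case using insert by simp
qed (simp_all add: valuation_0[OF assms(1)])

lemma valuation_sum_eq:
  fixes u :: "'f::field \<Rightarrow> 'g::linordered_ab_group_add extended"
  assumes "valuation u" "finite A" "j \<in> A" "u (t j) = Fin M"
    and "\<And>i. i \<in> A \<Longrightarrow> i \<noteq> j \<Longrightarrow> Fin M < u (t i)"
  shows "u (\<Sum>i\<in>A. t i) = Fin M"
proof -
  have "Fin M < u (\<Sum>i\<in>A - {j}. t i)" by (rule valuation_sum_gt) (use assms in auto)
  then have "u (t j + (\<Sum>i\<in>A - {j}. t i)) = u (t j)" using assms by (intro valuation_add_eq) auto
  then show ?thesis using assms by (simp add: sum.remove)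
qed

lemma nat_mult_simps [simp]: "nat_mult 0 c = 0" "nat_mult (Suc n) c = nat_mult n c + c"
  by (simp_all add: nat_mult_def add.commute)

lemma nat_mult_add: "nat_mult (m + n) c = nat_mult m c + nat_mult n c"
  by (induction m) (simp_all add: ac_simps)

lemma valuation_power:
  fixes u :: "'f::field \<Rightarrow> 'g::linordered_ab_group_add extended"
  assumes "valuation u" "u x = Fin c" shows "u (x ^ n) = Fin (nat_mult n c)"
  using assms by (induction n) (auto simp: valuation_1 zero_extended_def valuationD(3) add.commute)

lemma extended_add_mono:
  fixes a b :: "'g::linordered_ab_group_add extended"
  assumes "Fin m \<le> a" "Fin n \<le> b"
  shows "Fin (m + n) \<le> a + b" "Fin m < a \<or> Fin n < b \<Longrightarrow> Fin (m + n) < a + b"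
  using assms by (cases a; cases b; auto intro: add_mono add_less_le_mono add_le_less_mono)+

lemma Fin_diff_shift:
  fixes a b :: "'g::linordered_ab_group_add"
  shows "Fin (a - b) \<le> x \<longleftrightarrow> Fin a \<le> x + Fin b" "Fin (a - b) < x \<longleftrightarrow> Fin a < x + Fin b"
    "x = Fin (a - b) \<longleftrightarrow> x + Fin b = Fin a"
  by (cases x; auto simp: diff_le_eq diff_less_eq)+

section \<open>Dominant terms\<close>

definition term_val ::
  "('l::field \<Rightarrow> 'g::linordered_ab_group_add extended) \<Rightarrow> 'g \<Rightarrow> 'l poly \<Rightarrow> nat \<Rightarrow> 'g extended" where
  "term_val v d p i = v (coeff p i) + Fin (nat_mult i d)"

text \<open>
  The Gauss value of \<open>p\<close> is recorded as the pair \<open>(m, k)\<close> of the minimum and the last index where it is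
  attained. In the graded ring of the Gauss valuation, which is a polynomial ring over the graded ring
  of \<open>v\<close>, the index \<open>k\<close> is the degree of the initial form of \<open>p\<close>; this is why it adds up over products.
\<close>

definition dominant ::
  "('l::field \<Rightarrow> 'g::linordered_ab_group_add extended) \<Rightarrow> 'g \<Rightarrow> 'l poly \<Rightarrow> 'g \<Rightarrow> nat \<Rightarrow> bool" where
  "dominant v d p m k \<longleftrightarrow>
     term_val v d p k = Fin m \<and> (\<forall>i. Fin m \<le> term_val v d p i) \<and> (\<forall>i>k. Fin m < term_val v d p i)"

lemma dominant_value_unique:
  assumes "dominant v d p m k" "dominant v d p m' k'" shows "m = m'"
  using assms unfolding dominant_def by (metis antisym less_eq_extended.simps(1))

text \<open>
  The convolution sum for the coefficient of index \<open>k + l\<close> has the single minimal summand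
  \<open>(k, l)\<close>: any other pair of indices with the same sum exceeds \<open>k\<close> or \<open>l\<close> in one place. Beyond
  \<open>k + l\<close> all summands are strictly larger for the same reason.
\<close>

lemma dominant_mult:
  fixes v :: "'l::field \<Rightarrow> 'g::linordered_ab_group_add extended"
  assumes v: "valuation v" and p: "dominant v d p m k" and q: "dominant v d q n l"
  shows "dominant v d (p * q) (m + n) (k + l)"
proof -
  have cell: "v (coeff p i * coeff q j) + Fin (nat_mult (i + j) d) = term_val v d p i + term_val v d q j"
    for i j
    by (simp add: term_val_def valuationD(3)[OF v] nat_mult_add ac_simps flip: plus_extended.simps(1))
  have ge: "Fin (m + n) \<le> term_val v d p i + term_val v d q j" for i j
    using p q by (intro extended_add_mono) (auto simp: dominant_def)
  have gt: "Fin (m + n) < term_val v d p i + term_val v d q j" if "k < i \<or> l < j" for i j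
    using p q that by (intro extended_add_mono) (auto simp: dominant_def)
  have eq: "term_val v d p k + term_val v d q l = Fin (m + n)"
    using p q by (auto simp: dominant_def)
  have prod: "term_val v d (p * q) s = v (\<Sum>i\<le>s. coeff p i * coeff q (s - i)) + Fin (nat_mult s d)" for s
    by (simp add: term_val_def coeff_mult)
  have *: "v (coeff p i * coeff q (s - i)) + Fin (nat_mult s d) = term_val v d p i + term_val v d q (s - i)"
    if "i \<le> s" for i s
    using cell[of i "s - i"] that by simp
  have "Fin (m + n) \<le> term_val v d (p * q) s" for s
    unfolding prod Fin_diff_shift(1)[symmetric]
    by (intro valuation_sum_ge[OF v]) (auto simp: Fin_diff_shift(1) * ge)
  moreover have "Fin (m + n) < term_val v d (p * q) s" if "k + l < s" for s
    unfolding prod Fin_diff_shift(2)[symmetric] using that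
    by (intro valuation_sum_gt[OF v]) (auto simp: Fin_diff_shift(2) * intro!: gt)
  moreover have "term_val v d (p * q) (k + l) = Fin (m + n)"
    unfolding prod Fin_diff_shift(3)[symmetric]
  proof (rule valuation_sum_eq[OF v, where j = k])
    show "v (coeff p k * coeff q (k + l - k)) = Fin (m + n - nat_mult (k + l) d)"
      using *[of k "k + l"] eq by (simp add: Fin_diff_shift(3))
    show "Fin (m + n - nat_mult (k + l) d) < v (coeff p i * coeff q (k + l - i))"
      if "i \<in> {..k + l}" "i \<noteq> k" for i
      using that by (auto simp: Fin_diff_shift(2) * intro!: gt)
  qed auto
  ultimately show ?thesis by (simp add: dominant_def)
qed

lemma dominant_const:
  assumes "valuation v" "v c = Fin m" shows "dominant v d [:c:] m 0"
  using assms by (auto simp: dominant_def term_val_def coeff_pCons valuation_0 split: nat.split)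

lemma dominant_power:
  fixes v :: "'l::field \<Rightarrow> 'g::linordered_ab_group_add extended"
  assumes v: "valuation v" and p: "dominant v d p m k"
  shows "dominant v d (p ^ n) (nat_mult n m) (n * k)"
proof (induction n)
  case 0
  have "dominant v d [:1:] 0 0"
    by (rule dominant_const[OF v]) (simp add: valuation_1[OF v] zero_extended_def)
  then show ?case by (simp add: one_pCons)
next
  case (Suc n)
  from dominant_mult[OF v this p] show ?case by (simp add: mult.commute add.commute)
qed

text \<open>
  If the dominant indices are different, the minimal values cannot cancel. Among the summands with
  the least value, take the one with the largest dominant index; at this index every other summand is
  strictly larger.
\<close>

lemma dominant_sum:
  fixes v :: "'l::field \<Rightarrow> 'g::linordered_ab_group_add extended"
  assumes v: "valuation v" and A: "finite A" "A \<noteq> {}"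
    and t: "\<And>i. i \<in> A \<Longrightarrow> dominant v d (t i) (m i) (\<kappa> i)" and inj: "inj_on \<kappa> A"
  shows "\<exists>k. dominant v d (\<Sum>i\<in>A. t i) (Min (m ` A)) k"
proof -
  define M where "M = Min (m ` A)"
  define B where "B = {i \<in> A. m i = M}"
  have M: "M \<le> m i" if "i \<in> A" for i using A that by (simp add: M_def)
  have "M \<in> m ` A" unfolding M_def using A by (intro Min_in) auto
  then have B: "finite B" "B \<noteq> {}" using A by (auto simp: B_def)
  then have "Max (\<kappa> ` B) \<in> \<kappa> ` B" by (intro Max_in) auto
  then obtain j where j: "j \<in> B" "\<kappa> j = Max (\<kappa> ` B)" by auto
  have jA: "j \<in> A" and mj: "m j = M" using j by (auto simp: B_def)
  have jmax: "\<kappa> i \<le> \<kappa> j" if "i \<in> B" for i using j B that by simp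
  have ge: "Fin M \<le> term_val v d (t i) s" if "i \<in> A" for i s
  proof -
    have "Fin M \<le> Fin (m i)" using M[OF that] by simp
    also have "\<dots> \<le> term_val v d (t i) s" using t[OF that] by (simp add: dominant_def)
    finally show ?thesis .
  qed
  have gt: "Fin M < term_val v d (t i) s" if "i \<in> A" "\<kappa> j \<le> s" "i = j \<longrightarrow> \<kappa> j < s" for i s
  proof (cases "m i = M")
    case True
    then have "\<kappa> i \<le> \<kappa> j" using that by (intro jmax) (auto simp: B_def)
    moreover have "\<kappa> i = \<kappa> j \<Longrightarrow> i = j" using inj that jA by (auto dest: inj_onD)
    ultimately have "\<kappa> i < s" using that by force
    then show ?thesis using t[OF that(1)] True by (auto simp: dominant_def)
  next
    case False
    then have "Fin M < Fin (m i)" using M[OF that(1)] by simp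
    also have "\<dots> \<le> term_val v d (t i) s" using t[OF that(1)] by (simp add: dominant_def)
    finally show ?thesis .
  qed
  have sum: "term_val v d (\<Sum>i\<in>A. t i) s = v (\<Sum>i\<in>A. coeff (t i) s) + Fin (nat_mult s d)" for s
    by (simp add: term_val_def coeff_sum)
  have "Fin M \<le> term_val v d (\<Sum>i\<in>A. t i) s" for s
    unfolding sum Fin_diff_shift(1)[symmetric] using ge
    by (intro valuation_sum_ge[OF v]) (auto simp: Fin_diff_shift(1) term_val_def)
  moreover have "Fin M < term_val v d (\<Sum>i\<in>A. t i) s" if "\<kappa> j < s" for s
    unfolding sum Fin_diff_shift(2)[symmetric] using gt that
    by (intro valuation_sum_gt[OF v]) (auto simp: Fin_diff_shift(2) term_val_def)
  moreover have "term_val v d (\<Sum>i\<in>A. t i) (\<kappa> j) = Fin M"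
    unfolding sum Fin_diff_shift(3)[symmetric]
  proof (rule valuation_sum_eq[OF v A(1) jA])
    show "v (coeff (t j) (\<kappa> j)) = Fin (M - nat_mult (\<kappa> j) d)"
      using t[OF jA] mj by (simp add: Fin_diff_shift(3) dominant_def term_val_def)
    show "Fin (M - nat_mult (\<kappa> j) d) < v (coeff (t i) (\<kappa> j))" if "i \<in> A" "i \<noteq> j" for i
      using gt[of i "\<kappa> j"] that by (auto simp: Fin_diff_shift(2) term_val_def)
  qed
  ultimately show ?thesis unfolding M_def[symmetric] dominant_def by blast
qed

section \<open>Expansion about an algebraic point\<close>

lemma linear_valuation_finite:
  fixes wbar :: "'l::field poly fract \<Rightarrow> 'g::linordered_ab_group_add extended"
  assumes "valuation wbar"
  obtains d where "wbar (to_fract [:- \<alpha>, 1:]) = Fin d"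
  using valuation_Fin[OF assms, of "to_fract [:- \<alpha>, 1:]"] by auto

text \<open>
  Here \<open>vbar (\<alpha> - \<beta>)\<close> is the value of \<open>(X - \<beta>) - (X - \<alpha>)\<close>, so by the ultrametric inequality it is at
  least \<open>min d e\<close>, with equality if \<open>e < d\<close>. For \<open>e \<ge> d\<close> the linear term, of value \<open>d\<close>, is the last
  minimal one.
\<close>

lemma dominant_linear:
  fixes wbar :: "'l::field poly fract \<Rightarrow> 'g::linordered_ab_group_add extended"
  assumes vb: "valuation vbar" and wb: "valuation wbar" and ext: "extends_to_rat vbar wbar"
    and d: "wbar (to_fract [:- \<alpha>, 1:]) = Fin d" and e: "wbar (to_fract [:- \<beta>, 1:]) = Fin e"
  shows "dominant vbar d [:\<alpha> - \<beta>, 1:] (min d e) (if e < d then 0 else 1)"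
proof -
  have val: "vbar (\<alpha> - \<beta>) = wbar (to_fract [:- \<beta>, 1:] - to_fract [:- \<alpha>, 1:])"
    using ext unfolding extends_to_rat_def to_fract_diff[symmetric] by simp
  have terms: "term_val vbar d [:\<alpha> - \<beta>, 1:] i =
      (if i = 0 then vbar (\<alpha> - \<beta>) else if i = 1 then Fin d else \<infinity>)" for i
    by (auto simp: term_val_def valuation_0[OF vb] valuation_1[OF vb] coeff_pCons
        simp flip: zero_extended_def split: nat.split)
  have ge: "Fin (min d e) \<le> vbar (\<alpha> - \<beta>)"
    using valuationD(4)[OF wb, of "to_fract [:- \<beta>, 1:]" "- to_fract [:- \<alpha>, 1:]"] d e
    by (simp add: val valuation_uminus[OF wb] min.commute)
  have eq: "vbar (\<alpha> - \<beta>) = Fin e" if "e < d"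
    using valuation_add_eq[OF wb, of "to_fract [:- \<beta>, 1:]" "- to_fract [:- \<alpha>, 1:]"] d e that
    by (simp add: val valuation_uminus[OF wb])
  show ?thesis
  proof (cases "e < d")
    case True
    then show ?thesis using eq by (simp add: dominant_def terms)
  next
    case False
    then show ?thesis using ge by (simp add: dominant_def terms min_def split: if_splits)
  qed
qed

text \<open>
  Composition with \<open>X + \<alpha>\<close> turns the coefficients at \<open>0\<close> into those at \<open>\<alpha>\<close>. The values \<open>m\<close> and
  \<open>wbar p\<close> are sums over the roots \<open>\<beta>\<close> of \<open>p\<close>, of \<open>min d (wbar (X - \<beta>))\<close> and of \<open>wbar (X - \<beta>)\<close>
  respectively, plus the value of the leading coefficient; this gives the comparison. The index \<open>k\<close> is
  the number of roots with \<open>wbar (X - \<beta>) \<ge> d\<close>.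
\<close>

lemma dominant_centred:
  fixes wbar :: "'l::alg_closed_field poly fract \<Rightarrow> 'g::linordered_ab_group_add extended"
  assumes vb: "valuation vbar" and wb: "valuation wbar" and ext: "extends_to_rat vbar wbar"
    and d: "wbar (to_fract [:- \<alpha>, 1:]) = Fin d" and "p \<noteq> 0"
  shows "\<exists>m k. dominant vbar d (pcompose p [:\<alpha>, 1:]) m k \<and>
           Fin m \<le> wbar (to_fract p) \<and>
           (Fin m = wbar (to_fract p) \<longleftrightarrow> (\<forall>\<beta>. poly p \<beta> = 0 \<longrightarrow> wbar (to_fract [:- \<beta>, 1:]) \<le> Fin d)) \<and>
           (k = 0 \<longleftrightarrow> (\<forall>\<beta>. poly p \<beta> = 0 \<longrightarrow> wbar (to_fract [:- \<beta>, 1:]) < Fin d))"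
  using \<open>p \<noteq> 0\<close>
proof (induction "degree p" arbitrary: p)
  case 0
  then obtain c where c: "p = [:c:]" "c \<noteq> 0" by (metis degree_eq_zeroE pCons_0_0)
  obtain m where m: "vbar c = Fin m" using valuation_Fin[OF vb c(2)] .
  have "dominant vbar d (pcompose p [:\<alpha>, 1:]) m 0" using dominant_const[OF vb m] c by simp
  moreover have "wbar (to_fract p) = Fin m" using ext c m by (simp add: extends_to_rat_def)
  ultimately show ?case using c by (intro exI[of _ m] exI[of _ 0]) auto
next
  case (Suc n)
  then obtain \<beta> where "poly p \<beta> = 0" using alg_closed_imp_poly_has_root[of p] by auto
  then obtain q where q: "p = [:- \<beta>, 1:] * q" by (auto simp: poly_eq_0_iff_dvd)
  with Suc have q0: "q \<noteq> 0" by auto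
  then have deg: "degree p = Suc (degree q)" by (simp add: q degree_mult_eq del: mult_pCons_left)
  obtain e where e: "wbar (to_fract [:- \<beta>, 1:]) = Fin e" using linear_valuation_finite[OF wb] .
  obtain a where a: "wbar (to_fract q) = Fin a" using valuation_Fin[OF wb] q0 by (metis to_fract_eq_0_iff)
  have pval: "wbar (to_fract p) = Fin (e + a)"
    by (simp only: q to_fract_mult valuationD(3)[OF wb] e a plus_extended.simps)
  have roots: "poly p \<beta>' = 0 \<longleftrightarrow> \<beta>' = \<beta> \<or> poly q \<beta>' = 0" for \<beta>' by (auto simp: q)
  from Suc.hyps(1)[of q] Suc.hyps(2) deg q0
  obtain m k where mk: "dominant vbar d (pcompose q [:\<alpha>, 1:]) m k" "m \<le> a"
    "m = a \<longleftrightarrow> (\<forall>\<beta>. poly q \<beta> = 0 \<longrightarrow> wbar (to_fract [:- \<beta>, 1:]) \<le> Fin d)"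
    "k = 0 \<longleftrightarrow> (\<forall>\<beta>. poly q \<beta> = 0 \<longrightarrow> wbar (to_fract [:- \<beta>, 1:]) < Fin d)"
    using a by auto
  define l :: nat where "l = (if e < d then 0 else 1)"
  have "pcompose p [:\<alpha>, 1:] = [:\<alpha> - \<beta>, 1:] * pcompose q [:\<alpha>, 1:]"
    by (simp add: q pcompose_mult pcompose_pCons del: mult_pCons_left)
  then have "dominant vbar d (pcompose p [:\<alpha>, 1:]) (min d e + m) (l + k)"
    using dominant_mult[OF vb dominant_linear[OF vb wb ext d e] mk(1)] by (simp add: l_def)
  moreover have "min d e + m \<le> e + a" using mk(2) by (intro add_mono) auto
  moreover have "min d e + m = e + a \<longleftrightarrow> e \<le> d \<and> m = a"
    using mk(2) add_less_le_mono[of "min d e" e m a]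
    by (cases "e \<le> d") (auto simp: min_absorb2 min_absorb1 not_le)
  moreover have "l + k = 0 \<longleftrightarrow> e < d \<and> k = 0" by (simp add: l_def)
  ultimately show ?case
    unfolding pval roots using e mk(3,4)
    by (intro exI[of _ "min d e + m"] exI[of _ "l + k"]) auto
qed

lemma map_poly_to_ac_add: "map_poly to_ac (p + q) = map_poly to_ac p + map_poly to_ac q"
  by (rule poly_eqI) (simp add: coeff_map_poly)

lemma map_poly_to_ac_mult: "map_poly to_ac (p * q) = map_poly to_ac p * map_poly to_ac q"
  by (rule poly_eqI) (simp add: coeff_map_poly coeff_mult to_ac_sum)

lemma map_poly_to_ac_sum: "map_poly to_ac (\<Sum>i\<in>A. t i) = (\<Sum>i\<in>A. map_poly to_ac (t i))"
  by (induction A rule: infinite_finite_induct) (simp_all add: map_poly_to_ac_add)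

lemma map_poly_to_ac_eq_0_iff: "map_poly to_ac p = 0 \<longleftrightarrow> p = 0"
  by (simp add: map_poly_eq_0_iff)

lemma degree_map_poly_to_ac: "degree (map_poly to_ac p) = degree p"
  by (simp add: degree_map_poly)

section \<open>Truncation at an abstract key polynomial\<close>

context
  fixes w :: "'k::field poly fract \<Rightarrow> 'g::linordered_ab_group_add extended"
    and vbar :: "'k alg_closure \<Rightarrow> 'g extended"
    and wbar :: "'k alg_closure poly fract \<Rightarrow> 'g extended"
  assumes w: "valuation w" and vb: "valuation vbar" and wb: "valuation wbar"
    and ext_bar: "extends_to_rat vbar wbar" and ext_ac: "extends_rat_to_ac w wbar"
begin

lemma wbar_map_poly: "wbar (to_fract (map_poly to_ac f)) = w (to_fract f)"
  using ext_ac unfolding extends_rat_to_ac_def by (metis div_by_1 map_poly_1' one_neq_zero to_ac_1 to_fract_1)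

lemma delta_properties:
  assumes "degree f > 0"
  shows "\<exists>\<alpha>. poly (map_poly to_ac f) \<alpha> = 0 \<and> wbar (to_fract [:- \<alpha>, 1:]) = delta wbar f"
    and "delta wbar f \<le> c \<longleftrightarrow> (\<forall>\<beta>. poly (map_poly to_ac f) \<beta> = 0 \<longrightarrow> wbar (to_fract [:- \<beta>, 1:]) \<le> c)"
    and "delta wbar f < c \<longleftrightarrow> (\<forall>\<beta>. poly (map_poly to_ac f) \<beta> = 0 \<longrightarrow> wbar (to_fract [:- \<beta>, 1:]) < c)"
proof -
  define R where "R = {\<alpha>. poly (map_poly to_ac f) \<alpha> = 0}"
  have "f \<noteq> 0" using assms by auto
  then have fin: "finite R" unfolding R_def by (intro poly_roots_finite) (simp add: map_poly_to_ac_eq_0_iff)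
  have ne: "R \<noteq> {}" using alg_closed_imp_poly_has_root[of "map_poly to_ac f"] assms
    by (auto simp: R_def degree_map_poly_to_ac)
  have D: "delta wbar f = Max ((\<lambda>\<alpha>. wbar (to_fract [:- \<alpha>, 1:])) ` R)"
    unfolding delta_def R_def by (rule arg_cong[where f = Max]) auto
  have "delta wbar f \<in> (\<lambda>\<alpha>. wbar (to_fract [:- \<alpha>, 1:])) ` R"
    unfolding D using fin ne by (intro Max_in) auto
  then show "\<exists>\<alpha>. poly (map_poly to_ac f) \<alpha> = 0 \<and> wbar (to_fract [:- \<alpha>, 1:]) = delta wbar f"
    by (auto simp: R_def)
  show "delta wbar f \<le> c \<longleftrightarrow> (\<forall>\<beta>. poly (map_poly to_ac f) \<beta> = 0 \<longrightarrow> wbar (to_fract [:- \<beta>, 1:]) \<le> c)"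
    unfolding D using fin ne by (subst Max_le_iff) (auto simp: R_def)
  show "delta wbar f < c \<longleftrightarrow> (\<forall>\<beta>. poly (map_poly to_ac f) \<beta> = 0 \<longrightarrow> wbar (to_fract [:- \<beta>, 1:]) < c)"
    unfolding D using fin ne by (subst Max_less_iff) (auto simp: R_def)
qed

text \<open>
  The terms \<open>f\<^sub>i Q\<^sup>i\<close> of the \<open>Q\<close>-expansion have as dominant indices the multiples \<open>i K\<close> of the
  positive dominant index \<open>K\<close> of \<open>Q\<close>, and their Gauss values are their values under \<open>w\<close>, because
  \<open>wbar (X - \<beta>) \<le> d\<close> for all roots \<open>\<beta>\<close> of \<open>Q\<close> and of the nonzero coefficients \<open>f\<^sub>i\<close>. Since
  distinct dominant indices exclude cancellation, the least of these values is the Gauss value of \<open>f\<close>.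
\<close>

lemma truncation_eq_dominant_value:
  assumes ABKP: "ABKP wbar Q"
    and \<alpha>: "poly (map_poly to_ac Q) \<alpha> = 0" and d: "wbar (to_fract [:- \<alpha>, 1:]) = Fin d"
    and dQ: "delta wbar Q = Fin d" and "f \<noteq> 0"
  shows "\<exists>m k. truncation w Q f = Fin m \<and> dominant vbar d (pcompose (map_poly to_ac f) [:\<alpha>, 1:]) m k"
proof -
  have Q: "degree Q > 0" using ABKP by (simp add: ABKP_def)
  have small: "delta wbar g < delta wbar Q" if "0 < degree g" "degree g < degree Q" for g
    using ABKP that by (auto simp: ABKP_def)
  (* the expansion of a polynomial over K about the root \<alpha> *)
  define sh where "sh p = pcompose (map_poly to_ac p) [:\<alpha>, 1:]" for p :: "'k poly"
  have sh_mult: "sh (p * q) = sh p * sh q"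
    and sh_sum: "sh (\<Sum>i\<in>A. t i) = (\<Sum>i\<in>A. sh (t i))" for p q and A :: "nat set" and t
    by (simp_all add: sh_def map_poly_to_ac_mult map_poly_to_ac_sum pcompose_mult pcompose_sum)
  have sh_power: "sh (p ^ n) = sh p ^ n" for p n
    by (induction n) (simp_all add: sh_mult, simp add: sh_def pcompose_1)
  have Q0: "Q \<noteq> 0" using Q by auto
  note centred = dominant_centred[OF vb wb ext_bar d, of "map_poly to_ac p" for p,
      unfolded wbar_map_poly map_poly_to_ac_eq_0_iff, folded sh_def]
  have "\<forall>\<beta>. poly (map_poly to_ac Q) \<beta> = 0 \<longrightarrow> wbar (to_fract [:- \<beta>, 1:]) \<le> Fin d"
    using delta_properties(2)[OF Q, of "Fin d"] dQ by simp
  with centred[OF Q0] obtain a K where a: "w (to_fract Q) = Fin a" "dominant vbar d (sh Q) a K"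
    and "K = 0 \<longleftrightarrow> (\<forall>\<beta>. poly (map_poly to_ac Q) \<beta> = 0 \<longrightarrow> wbar (to_fract [:- \<beta>, 1:]) < Fin d)"
    by metis
  then have K: "K > 0" using \<alpha> d by force
  have low: "\<exists>b. w (to_fract g) = Fin b \<and> dominant vbar d (sh g) b 0" if "g \<noteq> 0" "degree g < degree Q" for g
  proof -
    have lt: "wbar (to_fract [:- \<beta>, 1:]) < Fin d" if r: "poly (map_poly to_ac g) \<beta> = 0" for \<beta>
    proof (cases "degree g = 0")
      case True
      then obtain c where "g = [:c:]" by (metis degree_eq_zeroE)
      with r \<open>g \<noteq> 0\<close> show ?thesis by (simp add: map_poly_pCons)
    next
      case False
      then show ?thesis
        using small[of g] delta_properties(3)[of g "Fin d"] that \<open>degree g < degree Q\<close> dQ r by auto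
    qed
    then show ?thesis using centred[OF that(1)] less_imp_le by metis
  qed
  define t where "t i = adic_coeff Q f i * Q ^ i" for i
  (* Zero coefficients contribute terms of infinite value, which have no dominant index. *)
  define A where "A = {i \<in> {..degree f}. adic_coeff Q f i \<noteq> 0}"
  have tdom: "\<exists>b. w (to_fract (t i)) = Fin b \<and> dominant vbar d (sh (t i)) b (i * K)" if i: "i \<in> A" for i
  proof -
    obtain b where b: "w (to_fract (adic_coeff Q f i)) = Fin b" "dominant vbar d (sh (adic_coeff Q f i)) b 0"
      using low[of "adic_coeff Q f i"] i degree_adic_coeff[OF Q] by (auto simp: A_def)
    have "w (to_fract Q ^ i) = Fin (nat_mult i a)" by (rule valuation_power[OF w a(1)])
    moreover have "to_fract (Q ^ i) = to_fract Q ^ i" by (induction i) simp_all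
    ultimately have "w (to_fract (t i)) = Fin (b + nat_mult i a)"
      by (simp add: t_def valuationD(3)[OF w] b)
    moreover have "dominant vbar d (sh (t i)) (b + nat_mult i a) (i * K)"
      using dominant_mult[OF vb b(2) dominant_power[OF vb a(2), of i]]
      by (simp add: t_def sh_mult sh_power)
    ultimately show ?thesis by blast
  qed
  then obtain m where m: "\<And>i. i \<in> A \<Longrightarrow> w (to_fract (t i)) = Fin (m i)"
    "\<And>i. i \<in> A \<Longrightarrow> dominant vbar d (sh (t i)) (m i) (i * K)" by metis
  have "f = (\<Sum>i\<le>degree f. t i)" using adic_expansion[OF Q, of f] by (simp add: t_def)
  also have "\<dots> = (\<Sum>i\<in>A. t i)" by (rule sum.mono_neutral_right) (auto simp: A_def t_def)
  finally have f: "f = (\<Sum>i\<in>A. t i)" .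
  have A: "finite A" "A \<noteq> {}"
    using f \<open>f \<noteq> 0\<close> by (simp add: A_def, metis sum.empty)
  have "\<exists>k. dominant vbar d (sh f) (Min (m ` A)) k"
    unfolding arg_cong[OF f, of sh] sh_sum
    by (rule dominant_sum[OF vb A]) (use m K in \<open>auto simp: inj_on_def\<close>)
  moreover have "truncation w Q f = Fin (Min (m ` A))"
    unfolding truncation_def t_def[symmetric]
  proof (rule Min_eqI)
    fix y assume "y \<in> (\<lambda>i. w (to_fract (t i))) ` {..degree f}"
    then obtain i where i: "i \<le> degree f" "y = w (to_fract (t i))" by auto
    show "Fin (Min (m ` A)) \<le> y"
    proof (cases "i \<in> A")
      case True
      then show ?thesis using m(1)[OF True] i A by simp
    next
      case False
      then show ?thesis using i by (simp add: A_def t_def valuation_0[OF w])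
    qed
  next
    have "Min (m ` A) \<in> m ` A" using A by (intro Min_in) auto
    then obtain i where "i \<in> A" "Min (m ` A) = m i" by auto
    then show "Fin (Min (m ` A)) \<in> (\<lambda>i. w (to_fract (t i))) ` {..degree f}"
      using m(1)[of i] by (auto simp: A_def intro!: image_eqI[of _ _ i])
  qed simp
  ultimately show ?thesis unfolding sh_def by blast
qed

text \<open>
  Both sides say that the Gauss value of \<open>f\<close> at a root of \<open>Q\<close> closest to \<open>X\<close> is its value under \<open>w\<close>.
\<close>

lemma truncation_eq_iff_delta_le:
  assumes ABKP: "ABKP wbar Q"
    and f: "degree f > 0"
  shows "truncation w Q f = w (to_fract f) \<longleftrightarrow> delta wbar f \<le> delta wbar Q"
proof -
  have Q: "degree Q > 0" using ABKP by (simp add: ABKP_def)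
  obtain \<alpha> where \<alpha>: "poly (map_poly to_ac Q) \<alpha> = 0" "wbar (to_fract [:- \<alpha>, 1:]) = delta wbar Q"
    using delta_properties(1)[OF Q] by blast
  obtain d where d: "wbar (to_fract [:- \<alpha>, 1:]) = Fin d" using linear_valuation_finite[OF wb] .
  have f0: "f \<noteq> 0" using f by auto
  obtain m k where m: "truncation w Q f = Fin m" "dominant vbar d (pcompose (map_poly to_ac f) [:\<alpha>, 1:]) m k"
    using truncation_eq_dominant_value[OF ABKP \<alpha>(1) d _ f0] \<alpha>(2) d by auto
  obtain m' k' where m': "dominant vbar d (pcompose (map_poly to_ac f) [:\<alpha>, 1:]) m' k'"
    "Fin m' = w (to_fract f) \<longleftrightarrow> delta wbar f \<le> Fin d"
    using dominant_centred[OF vb wb ext_bar d, of "map_poly to_ac f"] f0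
    unfolding wbar_map_poly map_poly_to_ac_eq_0_iff delta_properties(2)[OF f] by blast
  show ?thesis using dominant_value_unique[OF m(2) m'(1)] m'(2) m(1) \<alpha>(2) d by simp
qed

text \<open>
  By the criterion for equality, \<open>delta Q\<close> separates \<open>\<phi>\<close> from the nonconstant polynomials of smaller
  degree: it is an upper bound for their \<open>delta\<close>, and less than \<open>delta \<phi>\<close>.
\<close>

lemma ABKP_if_truncation_deficient:
  assumes ABKP: "ABKP wbar Q" and \<phi>: "lead_coeff \<phi> = 1" "degree \<phi> > 0"
    and agree: "\<And>f. degree f < degree \<phi> \<Longrightarrow> truncation w Q f = w (to_fract f)"
    and deficient: "truncation w Q \<phi> \<noteq> w (to_fract \<phi>)"
  shows "ABKP wbar \<phi>"
proof -
  have "delta wbar f < delta wbar \<phi>" if f: "0 < degree f" "degree f < degree \<phi>" for f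
  proof -
    note iff = truncation_eq_iff_delta_le[OF ABKP]
    have "delta wbar f \<le> delta wbar Q" using iff[of f] agree f by blast
    moreover have "delta wbar Q < delta wbar \<phi>" using iff[of \<phi>] deficient \<phi> by force
    ultimately show ?thesis by simp
  qed
  with \<phi> show ?thesis by (simp add: ABKP_def)
qed

end

section \<open>Maclane chains\<close>

lemma adic_coeff_less:
  assumes "degree f < degree \<phi>"
  shows "adic_coeff \<phi> f i = (if i = 0 then f else 0)"
proof (cases "i = 0")
  case False
  have "degree \<phi> \<le> degree (\<phi> ^ i)" using False assms by (subst degree_power_eq) auto
  then show ?thesis using assms False by (simp add: adic_coeff_def div_poly_less)
qed (use assms in \<open>simp add: adic_coeff_def mod_poly_less\<close>)

lemma adic_coeff_self:
  assumes "degree \<phi> > 0"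
  shows "adic_coeff \<phi> \<phi> i = (if i = 1 then 1 else 0)"
proof -
  consider "i = 0" | "i = 1" | "i > 1" by linarith
  then show ?thesis
  proof cases
    case 3
    have "degree \<phi> < i * degree \<phi>" using 3 assms by simp
    also have "\<dots> = degree (\<phi> ^ i)" using assms by (subst degree_power_eq) auto
    finally show ?thesis using 3 by (simp add: adic_coeff_def div_poly_less)
  next
    case 2
    have "\<phi> \<noteq> 0" using assms by auto
    then show ?thesis using 2 assms by (simp add: adic_coeff_def mod_poly_less)
  qed (use assms in \<open>auto simp: adic_coeff_def mod_poly_less\<close>)
qed

lemma augmentation_less:
  assumes "u 0 = \<infinity>" "degree f < degree \<phi>"
  shows "augmentation u \<phi> \<gamma> f = u f"
  unfolding augmentation_def
  by (rule Min_eqI) (use assms in \<open>auto simp: adic_coeff_less image_iff add.right_neutral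
      zero_extended_def[symmetric] intro!: bexI[of _ 0]\<close>)

lemma augmentation_self:
  assumes "u 0 = \<infinity>" "u 1 = 0" "degree \<phi> > 0"
  shows "augmentation u \<phi> \<gamma> \<phi> = Fin \<gamma>"
  unfolding augmentation_def
  by (rule Min_eqI) (use assms in \<open>auto simp: adic_coeff_self zero_extended_def intro!: image_eqI[of _ _ 1]\<close>)

text \<open>
  An augmentation depends on the values of \<open>u\<close> in degrees below \<open>degree \<phi>\<close> and on \<open>\<gamma>\<close> only; if \<open>w\<close>
  shares these data, the augmentation is a truncation of \<open>w\<close>.
\<close>

lemma augmentation_eq_truncation:
  assumes w: "valuation w" and \<phi>: "degree \<phi> > 0"
    and u: "\<And>f. degree f < degree \<phi> \<Longrightarrow> u f = w (to_fract f)" and \<gamma>: "w (to_fract \<phi>) = Fin \<gamma>"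
  shows "augmentation u \<phi> \<gamma> f = truncation w \<phi> f"
proof -
  have "to_fract (\<phi> ^ i) = to_fract \<phi> ^ i" for i by (induction i) simp_all
  then show ?thesis
    by (simp add: augmentation_def truncation_def u degree_adic_coeff[OF \<phi>] valuationD(3)[OF w]
        valuation_power[OF w \<gamma>])
qed

lemma nat_mult_Pair_0: "nat_mult n (0, c) = (0, nat_mult n c)"
  by (induction n) (simp_all add: zero_prod_def)

text \<open>
  The expansion in a linear polynomial has constant coefficients, on which the minimal extension is
  \<open>v\<close> placed in the convex subgroup \<open>{0} \<times> \<Gamma>\<close>. The first step of a chain is therefore an
  augmentation within \<open>\<Gamma>\<close>, of a function that agrees with \<open>v\<close> on constants.
\<close>

lemma minimal_augmentation:
  assumes v: "valuation v" and \<phi>: "degree \<phi> = 1"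
    and U: "map_extended (Pair 0) \<circ> U = augmentation (minimal_extension v) \<phi> (0, \<gamma>)"
  shows "U = augmentation (\<lambda>f. v (lead_coeff f)) \<phi> \<gamma>"
proof
  fix f
  define T where "T i = v (lead_coeff (adic_coeff \<phi> f i)) + Fin (nat_mult i \<gamma>)" for i
  let ?h = "map_extended (Pair (0::int)) :: 'b extended \<Rightarrow> _"
  have mono: "mono ?h" 
  proof (rule monoI)
    fix x y :: "'b extended" assume "x \<le> y"
    then show "?h x \<le> ?h y" by (cases x; cases y) auto
  qed
  have inj: "inj ?h" by (rule extended.inj_map) (simp add: inj_on_def)
  have "minimal_extension v (adic_coeff \<phi> f i) + Fin (nat_mult i (0, \<gamma>)) = ?h (T i)" for i
  proof -
    have "degree (adic_coeff \<phi> f i) = 0" using degree_adic_coeff[of \<phi> f i] \<phi> by simp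
    then show ?thesis
      by (cases "v (lead_coeff (adic_coeff \<phi> f i))")
        (auto simp: minimal_extension_def T_def nat_mult_Pair_0 plus_prod_def)
  qed
  then have "?h (U f) = Min (?h ` T ` {..degree f})"
    using fun_cong[OF U, of f] by (simp add: augmentation_def image_image)
  also have "\<dots> = ?h (Min (T ` {..degree f}))" by (rule mono_Min_commute[OF mono, symmetric]) auto
  finally show "U f = augmentation (\<lambda>f. v (lead_coeff f)) \<phi> \<gamma> f"
    using inj by (auto simp: augmentation_def T_def dest: injD)
qed

theorem theorem2p28:
  fixes v :: "'k::field \<Rightarrow> 'g::linordered_ab_group_add extended"
    and w :: "'k poly fract \<Rightarrow> 'g extended"
    and vbar :: "'k alg_closure \<Rightarrow> 'g extended"
    and wbar :: "'k alg_closure poly fract \<Rightarrow> 'g extended"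
    and r :: nat
    and \<phi> :: "nat \<Rightarrow> 'k poly"
    and \<gamma> :: "nat \<Rightarrow> 'g"
    and W :: "nat \<Rightarrow> 'k poly \<Rightarrow> 'g extended"
  assumes "valuation v" and "valuation w" and "valuation vbar" and "valuation wbar"
    and "extends_to_rat v w"
    and "extends_to_ac v vbar"
    and "extends_to_rat vbar wbar"
    and "extends_rat_to_ac w wbar"
    and "optimal_Maclane_chain v w r \<phi> \<gamma> W"
  shows "complete_ABKPs w wbar {..r} \<phi> \<and> standard_indexing wbar {..r} \<phi>"
proof -
  note v = assms(1) and w = assms(2)
  from assms(9) have
    first: "ordinary_augmentation (minimal_extension v) (\<phi> 0) (0, \<gamma> 0) (map_extended (Pair 0) \<circ> W 0)" and
    step: "\<And>i. i < r \<Longrightarrow> ordinary_augmentation (W i) (\<phi> (Suc i)) (\<gamma> (Suc i)) (W (Suc i))" and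
    last: "\<And>f. W r f = w (to_fract f)" and
    deg0: "degree (\<phi> 0) = 1" and
    deg: "\<And>i. i < r \<Longrightarrow> degree (\<phi> i) < degree (\<phi> (Suc i))"
    unfolding optimal_Maclane_chain_def by auto
  have deg_less: "degree (\<phi> i) < degree (\<phi> j)" if "i < j" "j \<le> r" for i j
    using that
  proof (induction j)
    case (Suc j)
    then show ?case using deg[of j] by (cases "i = j") auto
  qed simp
  have deg_pos: "degree (\<phi> i) > 0" if "i \<le> r" for i
    using deg_less[of 0 i] deg0 that by (cases "i = 0") auto
  have monic: "lead_coeff (\<phi> i) = 1" if "i \<le> r" for i
    using first step[of "i - 1"] that
    by (cases i) (auto simp: ordinary_augmentation_def key_poly_def)
  (* U i is the valuation that step i augments. For the first step it is replaced by a function into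
     the value group of w that equals v on constants, so that all steps have the same form. *)
  define U where "U i = (case i of 0 \<Rightarrow> \<lambda>f. v (lead_coeff f) | Suc j \<Rightarrow> W j)" for i
  have aug: "W i = augmentation (U i) (\<phi> i) (\<gamma> i)" if "i \<le> r" for i
    using minimal_augmentation[OF v deg0, of "W 0" "\<gamma> 0"] first step that
    by (cases i) (auto simp: ordinary_augmentation_def U_def)
  have U0: "U i 0 = \<infinity> \<and> U i 1 = 0" if "i \<le> r" for i
    using that
  proof (induction i)
    case 0
    then show ?case using v by (simp add: U_def valuation_0 valuation_1)
  next
    case (Suc i)
    then have "U (Suc i) f = U i f" if "degree f < degree (\<phi> i)" for f
      using aug[of i] augmentation_less[of "U i" f "\<phi> i" "\<gamma> i"] that by (simp add: U_def)
    then show ?case using Suc deg_pos[of i] by simp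
  qed
  have W_less: "W i f = U i f" if "i \<le> r" "degree f < degree (\<phi> i)" for i f
    using aug U0 that by (simp add: augmentation_less)
  (* Later augmentations are at polynomials of degree at least that of the next one, and do not
     change the value of a polynomial of smaller degree. *)
  have W_stable: "W i f = w (to_fract f)" if "i \<le> r" "i < r \<Longrightarrow> degree f < degree (\<phi> (Suc i))" for i f
    using that
  proof (induction rule: inc_induct)
    case (step i)
    then have "degree f < degree (\<phi> (Suc i))" by simp
    then have "W (Suc i) f = w (to_fract f)" using deg[of "Suc i"] by (intro step.IH) simp
    moreover have "W (Suc i) f = W i f" using W_less[of "Suc i" f] step by (simp add: U_def)
    ultimately show ?case by simp
  qed (rule last)
  have U_w: "U i f = w (to_fract f)" if "i \<le> r" "degree f < degree (\<phi> i)" for i f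
    using W_stable[OF that(1) less_trans[OF that(2) deg]] W_less[OF that] by simp
  have value_phi: "w (to_fract (\<phi> i)) = Fin (\<gamma> i)" if "i \<le> r" for i
    using W_stable[OF that deg] augmentation_self[of "U i" "\<phi> i" "\<gamma> i"] U0 aug deg_pos that
    by simp
  have W_trunc: "W i = truncation w (\<phi> i)" if "i \<le> r" for i
  proof
    show "W i f = truncation w (\<phi> i) f" for f
      unfolding aug[OF that] using augmentation_eq_truncation[OF w deg_pos U_w value_phi] that by simp
  qed
  have ABKP: "ABKP wbar (\<phi> i)" if "i \<le> r" for i
    using that
  proof (induction i)
    case 0
    then show ?case using deg0 monic[of 0] by (auto simp: ABKP_def)
  next
    case (Suc i)
    have i: "i < r" "i \<le> r" using Suc.prems by auto
    show ?case
    proof (rule ABKP_if_truncation_deficient[OF w assms(3,4,7,8) Suc.IH[OF i(2)]])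
      show "truncation w (\<phi> i) g = w (to_fract g)" if "degree g < degree (\<phi> (Suc i))" for g
        using W_stable[OF i(2)] W_trunc[OF i(2)] that by metis
      have "W i (\<phi> (Suc i)) < Fin (\<gamma> (Suc i))"
        using step[OF i(1)] by (simp add: ordinary_augmentation_def)
      then show "truncation w (\<phi> i) (\<phi> (Suc i)) \<noteq> w (to_fract (\<phi> (Suc i)))"
        using W_trunc[OF i(2)] value_phi[of "Suc i"] Suc.prems by simp
    qed (use Suc.prems monic deg_pos in auto)
  qed
  have delta_less: "delta wbar (\<phi> i) < delta wbar (\<phi> j)" if "i < j" "j \<le> r" for i j
    using ABKP[of j] deg_less[of i j] deg_pos[of i] that by (simp add: ABKP_def)
  then have delta_neq: "delta wbar (\<phi> i) \<noteq> delta wbar (\<phi> j)" if "i \<le> r" "j \<le> r" "i \<noteq> j" for i j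
    using that by (metis less_irrefl linorder_neqE_nat)
  have "complete_ABKPs w wbar {..r} \<phi>"
    unfolding complete_ABKPs_def
  proof (intro conjI)
    show "\<forall>i\<in>{..r}. ABKP wbar (\<phi> i)"
      using ABKP by simp
    show "\<forall>i\<in>{..r}. \<forall>j\<in>{..r}. i \<noteq> j \<longrightarrow> delta wbar (\<phi> i) \<noteq> delta wbar (\<phi> j)"
      using delta_neq by simp
    show "\<forall>f. \<exists>i\<in>{..r}. truncation w (\<phi> i) f = w (to_fract f)"
      using W_trunc[of r] last by (metis atMost_iff order_refl)
    let ?S = "\<phi> ` {..r}"
    let ?R = "{(P, P'). P \<in> ?S \<and> P' \<in> ?S \<and> (P = P' \<or> delta wbar P < delta wbar P')}"
    have "linear_order_on ?S ?R"
      unfolding linear_order_on_def partial_order_on_def preorder_on_def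
    proof (intro conjI)
      show "total_on ?S ?R" unfolding total_on_def using delta_neq by force
    qed (auto simp: refl_on_def trans_def antisym_def)
    moreover have "wf (?R - Id)"
    proof (rule finite_acyclic_wf)
      show "finite (?R - Id)" by (rule finite_subset[of _ "?S \<times> ?S"]) auto
      have "trans (?R - Id)" by (auto simp: trans_def)
      then show "acyclic (?R - Id)" by (simp add: acyclic_irrefl trancl_id irrefl_def)
    qed
    ultimately show "well_order_on ?S ?R" by (simp add: well_order_on_def)
  qed
  moreover have "standard_indexing wbar {..r} \<phi>"
    unfolding standard_indexing_def
    by (rule exI[of _ "{..r}"], rule exI[of _ id], rule exI[of _ "\<lambda>_. {}"])
      (use deg delta_less in auto)
  ultimately show ?thesis ..
qed

end
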